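(* Let $G$ be a finite non-abelian group, let $\chi$ be the character of an irreducible complex representation of $G$ of dimension $n>1$, and let $K$, $G_0$, $\gamma=\gamma_0>\gamma_1>\cdots>\gamma_l=0$, $C_0,\dots,C_l$ and $a_1,\dots,a_k$ be as defined in the context, with $\gamma>0$. Then $$\gamma_i\;\le\;\left(\frac{\sum_{j=1}^k a_j^{2}-n^{4}|K|/|G|}{(|C_0|+\cdots+|C_i|)/|G|}\right)^{1/4},\qquad i=1,\dots,l,$$ and in particular $$\left(\frac{|G|\sum_{i=1}^k a_i^{2}-|K|n^4}{|G|-|G_0|-|K|}\right)^{1/4}\;\le\;\gamma\;\le\;\left(\frac{|G|\sum_{i=1}^k a_i^{2}-|K|n^4}{|C_0|}\right)^{1/4}.$$
   Context: $|\chi|$ denotes the function $g\mapsto|\chi(g)|$ on $G$. $K=\{g\in G:|\chi(g)|=n\}$ is the normal subgroup of elements acting by scalars. $G_0=\{g\in G:\chi(g)=0\}$. $n>\gamma=\gamma_0>\gamma_1>\cdots>\gamma_l=0$ is the list of all distinct values of $|\chi|$; it is a standing assumption that $\gamma>0$. $C_q=\{g\in G:|\chi(g)|=\gamma_q\}$ for $q=0,\dots,l$ (so $C_l=G_0$). $\chi_1,\dots,\chi_k$ are all the pairwise distinct irreducible complex characters of $G$ that are trivial on $K$ (i.e. $\chi_i(g)=\chi_i(1)$ for $g\in K$), $\chi_1$ being the trivial character. The non-negative integers $a_1,\dots,a_k$ are the coefficients in $|\chi|^2=\chi\bar\chi=a_1\chi_1+\cdots+a_k\chi_k$. *)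

theory Defs
  imports
    Complex_Main
    "HOL-Algebra.Group"
    "Jordan_Normal_Form.VS_Connect"
begin

text \<open>A complex representation of dimension \<open>n\<close> is taken in matrix form, as a homomorphism
  into the unit group of the ring of complex \<open>n \<times> n\<close> matrices, acting on \<open>carrier_vec n\<close>.\<close>

definition GL :: "nat \<Rightarrow> complex mat monoid" where
  "GL n = units_of (ring_mat TYPE(complex) n ())"

definition complex_rep :: "('g, 'b) monoid_scheme \<Rightarrow> nat \<Rightarrow> ('g \<Rightarrow> complex mat) \<Rightarrow> bool" where
  "complex_rep G n \<rho> \<longleftrightarrow> \<rho> \<in> hom G (GL n)"

definition invariant_subspace ::
  "('g, 'b) monoid_scheme \<Rightarrow> nat \<Rightarrow> ('g \<Rightarrow> complex mat) \<Rightarrow> complex vec set \<Rightarrow> bool" where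
  "invariant_subspace G n \<rho> W \<longleftrightarrow>
     VectorSpace.subspace class_ring W (module_vec TYPE(complex) n) \<and>
     (\<forall>g \<in> carrier G. \<forall>w \<in> W. \<rho> g *\<^sub>v w \<in> W)"

definition irreducible_rep :: "('g, 'b) monoid_scheme \<Rightarrow> nat \<Rightarrow> ('g \<Rightarrow> complex mat) \<Rightarrow> bool" where
  "irreducible_rep G n \<rho> \<longleftrightarrow>
     complex_rep G n \<rho> \<and> n > 0 \<and>
     (\<forall>W. invariant_subspace G n \<rho> W \<longrightarrow> W = {0\<^sub>v n} \<or> W = carrier_vec n)"

definition mat_trace :: "complex mat \<Rightarrow> complex" where
  "mat_trace A = (\<Sum>i<dim_row A. A $$ (i, i))"

text \<open>Characters are made extensional (\<open>undefined\<close> outside the carrier), so that equality of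
  characters as HOL functions is equality as functions on the group.\<close>

definition rep_character :: "('g, 'b) monoid_scheme \<Rightarrow> ('g \<Rightarrow> complex mat) \<Rightarrow> 'g \<Rightarrow> complex" where
  "rep_character G \<rho> = (\<lambda>g \<in> carrier G. mat_trace (\<rho> g))"

definition irreducible_characters :: "('g, 'b) monoid_scheme \<Rightarrow> ('g \<Rightarrow> complex) set" where
  "irreducible_characters G = {\<chi>. \<exists>m \<rho>. irreducible_rep G m \<rho> \<and> \<chi> = rep_character G \<rho>}"

definition irreducible_characters_trivial_on ::
  "('g, 'b) monoid_scheme \<Rightarrow> 'g set \<Rightarrow> ('g \<Rightarrow> complex) set" where
  "irreducible_characters_trivial_on G K =
     {\<psi> \<in> irreducible_characters G. \<forall>g \<in> K. \<psi> g = \<psi> \<one>\<^bsub>G\<^esub>}"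

definition modulus_level_set ::
  "('g, 'b) monoid_scheme \<Rightarrow> ('g \<Rightarrow> complex) \<Rightarrow> real \<Rightarrow> 'g set" where
  "modulus_level_set G \<chi> r = {g \<in> carrier G. cmod (\<chi> g) = r}"

text \<open>The values \<open>\<gamma>\<^sub>0 > \<gamma>\<^sub>1 > \<dots> > \<gamma>\<^sub>l\<close> of \<open>\<bar>\<chi>\<bar>\<close> other than the
  degree \<open>n\<close>, in decreasing order. That the list starts below \<open>n\<close> and ends with \<open>0\<close>
  (Burnside) for irreducible \<open>\<chi>\<close> of degree \<open>n > 1\<close> is a property of \<open>\<chi>\<close>, not part of
  the definition.\<close>

definition modulus_values ::
  "('g, 'b) monoid_scheme \<Rightarrow> ('g \<Rightarrow> complex) \<Rightarrow> nat \<Rightarrow> real list" where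
  "modulus_values G \<chi> n =
     rev (sorted_list_of_set ((\<lambda>g. cmod (\<chi> g)) ` carrier G - {real n}))"

end

theory Submission
  imports Defs "Jordan_Normal_Form.Spectral_Radius"
begin

text \<open>
  Everything follows from one identity for the fourth moment of \<open>\<chi>\<close>. Expanding
  \<open>\<bar>\<chi>\<bar>\<^sup>2 = \<Sum>j. a j * X j\<close> in the orthonormal family \<open>X\<close> gives
  \<open>(\<Sum>g\<in>G. \<bar>\<chi> g\<bar>^4) = \<bar>G\<bar> * (\<Sum>j. (a j)^2)\<close>, and removing the contribution \<open>\<bar>K\<bar> * n^4\<close> of
  \<open>K\<close> leaves \<open>R = (\<Sum>g\<in>G - K. \<bar>\<chi> g\<bar>^4)\<close>, which up to a factor \<open>\<bar>G\<bar>\<close> is the numerator in all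
  three estimates.
  On the disjoint sets \<open>C 0, \<dots>, C i\<close> outside \<open>K\<close> the modulus is at least \<open>\<gamma> i\<close>, so
  \<open>(\<gamma> i)^4 * (\<bar>C 0\<bar> + \<dots> + \<bar>C i\<bar>) \<le> R\<close>; outside \<open>K\<close> and \<open>G0\<close>, where the terms of \<open>R\<close> are
  nonzero, the modulus is at most \<open>\<gamma> 0\<close>, so \<open>R \<le> (\<gamma> 0)^4 * (\<bar>G\<bar> - \<bar>G0\<bar> - \<bar>K\<bar>)\<close>.

  The representation theory behind this is the orthogonality of irreducible characters
  (\<open>character_inner_distinct\<close>, \<open>character_inner_self\<close>). It is obtained by averaging a matrix unit
  to an intertwiner, which Schur's lemma (\<open>schur_zero_or_invertible\<close>, \<open>schur_scalar\<close>) forces to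
  be zero or scalar. This first gives a relation between \<open>\<chi> g\<close> and \<open>\<chi> (inv g)\<close>; the
  complex conjugate enters through \<open>mat_trace_inv\<close>. Orthogonality is used a second time, for
  \<open>\<chi>\<close> itself: \<open>(\<Sum>g\<in>G. \<bar>\<chi> g\<bar>^2) = \<bar>G\<bar>\<close> is incompatible with \<open>\<bar>\<chi>\<bar>\<close> being
  constantly \<open>n > 1\<close>, so that the list of moduli other than \<open>n\<close> is nonempty and \<open>\<gamma> 0\<close> is one of them.
\<close>

section \<open>Matrix entries, traces and sums of matrices\<close>

lemma mult_mat_index:
  assumes "A \<in> carrier_mat n m" and "B \<in> carrier_mat m l" and "i < n" and "j < l"
  shows "(A * B) $$ (i, j) = (\<Sum>r<m. A $$ (i, r) * B $$ (r, j))"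
  using assms by (simp add: scalar_prod_def atLeast0LessThan)

lemma mult_mat_vec_index:
  "A \<in> carrier_mat n m \<Longrightarrow> v \<in> carrier_vec m \<Longrightarrow> i < n \<Longrightarrow>
    (A *\<^sub>v v) $ i = (\<Sum>j<m. A $$ (i, j) * v $ j)"
  by (simp add: scalar_prod_def atLeast0LessThan)

lemma mult_mat_vec_zero: "A \<in> carrier_mat n m \<Longrightarrow> (A :: complex mat) *\<^sub>v 0\<^sub>v m = 0\<^sub>v n"
  by (intro eq_vecI) auto

lemma zero_mult_mat_vec: "v \<in> carrier_vec m \<Longrightarrow> 0\<^sub>m n m *\<^sub>v (v :: complex vec) = 0\<^sub>v n"
  by (intro eq_vecI) auto

lemma mat_eq_zeroI:
  assumes T: "T \<in> carrier_mat n m"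
    and ker: "\<And>v. v \<in> carrier_vec m \<Longrightarrow> T *\<^sub>v v = 0\<^sub>v n"
  shows "(T :: complex mat) = 0\<^sub>m n m"
proof (rule eq_matI)
  fix i j assume ij: "i < dim_row (0\<^sub>m n m)" "j < dim_col (0\<^sub>m n m)"
  have "T $$ (i, j) = (T *\<^sub>v unit_vec m j) $ i"
    using T ij by simp
  then show "T $$ (i, j) = 0\<^sub>m n m $$ (i, j)" using ker[of "unit_vec m j"] ij by simp
qed (use T in auto)

lemma mat_trace_mult_comm:
  assumes A: "A \<in> carrier_mat n m" and B: "B \<in> carrier_mat m n"
  shows "mat_trace (A * B) = mat_trace (B * A)"
proof -
  have "mat_trace (A * B) = (\<Sum>i<n. \<Sum>j<m. A $$ (i, j) * B $$ (j, i))"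
    using A B by (auto simp: mat_trace_def scalar_prod_def atLeast0LessThan intro!: sum.cong)
  also have "\<dots> = (\<Sum>j<m. \<Sum>i<n. B $$ (j, i) * A $$ (i, j))"
    by (subst sum.swap) (simp add: mult.commute)
  also have "\<dots> = mat_trace (B * A)"
    using A B by (auto simp: mat_trace_def scalar_prod_def atLeast0LessThan intro!: sum.cong)
  finally show ?thesis .
qed

text \<open>The trace is cyclic even for rectangular factors, so a two-sided inverse of \<open>T\<close> suffices and
  \<open>A\<close> and \<open>B\<close> need not be known to have the same size.\<close>

lemma mat_trace_eq_of_intertwining_invertible:
  assumes A: "A \<in> carrier_mat n n" and B: "B \<in> carrier_mat m m"
    and T: "T \<in> carrier_mat n m" and S: "S \<in> carrier_mat m n"
    and TS: "T * S = 1\<^sub>m n" and ST: "S * T = 1\<^sub>m m"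
    and comm: "A * T = T * B"
  shows "mat_trace A = mat_trace B"
proof -
  have "A = A * (T * S)" using A TS by simp
  also have "\<dots> = A * T * S" using A T S by simp
  also have "\<dots> = T * (B * S)" using T B S by (simp add: comm)
  finally have "mat_trace A = mat_trace (B * S * T)"
    using mat_trace_mult_comm[OF T, of "B * S"] B S by simp
  also have "B * S * T = B" using B S T ST by simp
  finally show ?thesis .
qed

text \<open>The dimensions are explicit because the zero matrix, the value of an empty sum, depends on
  them.\<close>

definition mat_sum :: "nat \<Rightarrow> nat \<Rightarrow> ('i \<Rightarrow> complex mat) \<Rightarrow> 'i set \<Rightarrow> complex mat" where
  "mat_sum n m f I = mat n m (\<lambda>ij. \<Sum>x\<in>I. f x $$ ij)"

lemma mat_sum_carrier [simp]: "mat_sum n m f I \<in> carrier_mat n m"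
  by (simp add: mat_sum_def)

lemma mat_sum_dim [simp]: "dim_row (mat_sum n m f I) = n" "dim_col (mat_sum n m f I) = m"
  by (simp_all add: mat_sum_def)

lemma mat_sum_index [simp]:
  "i < n \<Longrightarrow> j < m \<Longrightarrow> mat_sum n m f I $$ (i, j) = (\<Sum>x\<in>I. f x $$ (i, j))"
  by (simp add: mat_sum_def)

lemma mult_mat_sum:
  assumes A: "A \<in> carrier_mat l n" and f: "\<And>x. x \<in> I \<Longrightarrow> f x \<in> carrier_mat n m"
  shows "A * mat_sum n m f I = mat_sum l m (\<lambda>x. A * f x) I"
proof (rule eq_matI)
  fix i j assume "i < dim_row (mat_sum l m (\<lambda>x. A * f x) I)"
    and "j < dim_col (mat_sum l m (\<lambda>x. A * f x) I)"
  then have ij: "i < l" "j < m" by simp_all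
  have "(A * mat_sum n m f I) $$ (i, j) = (\<Sum>r<n. \<Sum>x\<in>I. A $$ (i, r) * f x $$ (r, j))"
    using A ij by (simp add: scalar_prod_def atLeast0LessThan sum_distrib_left)
  also have "\<dots> = (\<Sum>x\<in>I. (A * f x) $$ (i, j))"
    using ij by (subst sum.swap) (simp add: mult_mat_index[OF A f])
  finally show "(A * mat_sum n m f I) $$ (i, j) = mat_sum l m (\<lambda>x. A * f x) I $$ (i, j)"
    using ij by simp
qed (use A in auto)

lemma mat_sum_mult:
  assumes B: "B \<in> carrier_mat m l" and f: "\<And>x. x \<in> I \<Longrightarrow> f x \<in> carrier_mat n m"
  shows "mat_sum n m f I * B = mat_sum n l (\<lambda>x. f x * B) I"
proof (rule eq_matI)
  fix i j assume "i < dim_row (mat_sum n l (\<lambda>x. f x * B) I)"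
    and "j < dim_col (mat_sum n l (\<lambda>x. f x * B) I)"
  then have ij: "i < n" "j < l" by simp_all
  have "(mat_sum n m f I * B) $$ (i, j) = (\<Sum>r<m. \<Sum>x\<in>I. f x $$ (i, r) * B $$ (r, j))"
    using B ij by (simp add: scalar_prod_def atLeast0LessThan sum_distrib_right)
  also have "\<dots> = (\<Sum>x\<in>I. (f x * B) $$ (i, j))"
    using ij by (subst sum.swap) (simp add: mult_mat_index[OF f B])
  finally show "(mat_sum n m f I * B) $$ (i, j) = mat_sum n l (\<lambda>x. f x * B) I $$ (i, j)"
    using ij by simp
qed (use B in auto)

lemma mat_sum_reindex:
  "bij_betw h I J \<Longrightarrow> (\<And>x. x \<in> I \<Longrightarrow> f x = g (h x)) \<Longrightarrow> mat_sum n m f I = mat_sum n m g J"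
  unfolding mat_sum_def
  by (intro cong_mat refl) (simp add: sum.reindex_bij_betw[symmetric])

lemma mat_trace_mat_sum:
  assumes "\<And>x. x \<in> I \<Longrightarrow> f x \<in> carrier_mat n n"
  shows "mat_trace (mat_sum n n f I) = (\<Sum>x\<in>I. mat_trace (f x))"
proof -
  have "mat_trace (mat_sum n n f I) = (\<Sum>i<n. \<Sum>x\<in>I. f x $$ (i, i))"
    by (simp add: mat_trace_def)
  also have "\<dots> = (\<Sum>x\<in>I. mat_trace (f x))"
    using assms by (subst sum.swap) (auto simp: mat_trace_def intro!: sum.cong)
  finally show ?thesis .
qed

section \<open>Representations and Schur's lemma\<close>

lemma group_GL: "group (GL n)"
  unfolding GL_def by (intro monoid.units_group ring.is_monoid ring_mat)

lemma complex_rep_carrier: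
  "complex_rep G n \<rho> \<Longrightarrow> g \<in> carrier G \<Longrightarrow> \<rho> g \<in> carrier_mat n n"
  by (auto simp: complex_rep_def hom_def GL_def units_of_def Units_def ring_mat_simps)

lemma complex_rep_mult:
  "complex_rep G n \<rho> \<Longrightarrow> g \<in> carrier G \<Longrightarrow> h \<in> carrier G \<Longrightarrow> \<rho> (g \<otimes>\<^bsub>G\<^esub> h) = \<rho> g * \<rho> h"
  by (auto simp: complex_rep_def hom_def GL_def units_of_def ring_mat_simps)

lemma (in group) complex_rep_one:
  assumes "complex_rep G n \<rho>"
  shows "\<rho> \<one> = 1\<^sub>m n"
  using hom_one[OF _ is_group group_GL] assms
  by (auto simp: complex_rep_def GL_def units_of_def ring_mat_simps)

lemma subspace_vecI:
  assumes "W \<subseteq> carrier_vec n" and "0\<^sub>v n \<in> W"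
    and "\<And>u v. u \<in> W \<Longrightarrow> v \<in> W \<Longrightarrow> u + v \<in> W" and "\<And>c v. v \<in> W \<Longrightarrow> c \<cdot>\<^sub>v v \<in> W"
  shows "VectorSpace.subspace class_ring W (module_vec TYPE(complex) n)"
  unfolding VectorSpace.subspace_def
  by (intro conjI vec_vs submodule.intro vec_module)
     (use assms in \<open>auto simp: module_vec_simps\<close>)

lemma irreducible_repD:
  assumes "irreducible_rep G n \<rho>"
  shows "complex_rep G n \<rho>" "n > 0"
  using assms by (auto simp: irreducible_rep_def)

lemma irreducible_rep_subspace_cases:
  assumes "irreducible_rep G n \<rho>"
    and "W \<subseteq> carrier_vec n" and "0\<^sub>v n \<in> W"
    and "\<And>u v. u \<in> W \<Longrightarrow> v \<in> W \<Longrightarrow> u + v \<in> W" and "\<And>c v. v \<in> W \<Longrightarrow> c \<cdot>\<^sub>v v \<in> W"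
    and "\<And>g w. g \<in> carrier G \<Longrightarrow> w \<in> W \<Longrightarrow> \<rho> g *\<^sub>v w \<in> W"
  obtains "W = {0\<^sub>v n}" | "W = carrier_vec n"
proof -
  have "invariant_subspace G n \<rho> W"
    unfolding invariant_subspace_def by (intro conjI subspace_vecI) (use assms in auto)
  then show ?thesis using assms(1) that unfolding irreducible_rep_def by blast
qed

text \<open>Kernel and image of an intertwiner are invariant subspaces, so a nonzero intertwiner is
  bijective. Its inverse is assembled columnwise from preimages of the standard basis vectors; it
  is a right inverse by construction and a left inverse by injectivity.\<close>

theorem schur_zero_or_invertible:
  assumes irr\<rho>: "irreducible_rep G n \<rho>" and irr\<sigma>: "irreducible_rep G m \<sigma>"
    and T: "T \<in> carrier_mat n m"
    and comm: "\<And>g. g \<in> carrier G \<Longrightarrow> \<rho> g * T = T * \<sigma> g"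
    and nz: "T \<noteq> 0\<^sub>m n m"
  obtains S where "S \<in> carrier_mat m n" "T * S = 1\<^sub>m n" "S * T = 1\<^sub>m m"
proof -
  note \<rho> = complex_rep_carrier[OF irreducible_repD(1)[OF irr\<rho>]]
  note \<sigma> = complex_rep_carrier[OF irreducible_repD(1)[OF irr\<sigma>]]
  define ker where "ker = {v \<in> carrier_vec m. T *\<^sub>v v = 0\<^sub>v n}"
  define img where "img = (\<lambda>v. T *\<^sub>v v) ` carrier_vec m"
  have act: "\<rho> g *\<^sub>v (T *\<^sub>v v) = T *\<^sub>v (\<sigma> g *\<^sub>v v)" if "g \<in> carrier G" "v \<in> carrier_vec m" for g v
    using assoc_mult_mat_vec[OF \<rho>[OF that(1)] T that(2)]
      assoc_mult_mat_vec[OF T \<sigma>[OF that(1)] that(2)] comm[OF that(1)] by simp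
  from nz obtain v where v: "v \<in> carrier_vec m" "T *\<^sub>v v \<noteq> 0\<^sub>v n"
    using mat_eq_zeroI[OF T] by blast
  have "ker \<noteq> carrier_vec m" using v by (auto simp: ker_def)
  then have inj: "ker = {0\<^sub>v m}"
  proof (rule_tac irreducible_rep_subspace_cases[OF irr\<sigma>, of ker])
    fix g w assume "g \<in> carrier G" "w \<in> ker"
    then show "\<sigma> g *\<^sub>v w \<in> ker"
      using act[of g w] mult_mat_vec_carrier[OF \<sigma>] mult_mat_vec_zero[OF \<rho>] by (simp add: ker_def)
  qed (use T in \<open>auto simp: ker_def mult_add_distrib_mat_vec mult_mat_vec\<close>)
  have "img \<noteq> {0\<^sub>v n}" using v by (auto simp: img_def)
  then have surj: "img = carrier_vec n"
  proof (rule_tac irreducible_rep_subspace_cases[OF irr\<rho>, of img])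
    fix g w assume "g \<in> carrier G" "w \<in> img"
    then show "\<rho> g *\<^sub>v w \<in> img"
      using act mult_mat_vec_carrier[OF \<sigma>] by (auto simp: img_def)
  next
    show "0\<^sub>v n \<in> img" unfolding img_def using T by (intro image_eqI[of _ _ "0\<^sub>v m"]) auto
  next
    fix u w assume "u \<in> img" "w \<in> img"
    then show "u + w \<in> img"
      using T by (auto simp: img_def simp flip: mult_add_distrib_mat_vec)
  next
    fix c u assume "u \<in> img"
    then show "c \<cdot>\<^sub>v u \<in> img"
      using T by (auto simp: img_def simp flip: mult_mat_vec)
  qed (use T in \<open>auto simp: img_def\<close>)
  have "\<forall>i<n. \<exists>v\<in>carrier_vec m. T *\<^sub>v v = unit_vec n i"
    using surj unfolding img_def by (metis imageE unit_vec_carrier)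
  then obtain s where s: "\<And>i. i < n \<Longrightarrow> s i \<in> carrier_vec m \<and> T *\<^sub>v s i = unit_vec n i"
    by metis
  define S where "S = mat_of_cols m (map s [0..<n])"
  have S: "S \<in> carrier_mat m n"
    unfolding S_def by (metis length_map length_upt diff_zero mat_of_cols_carrier(1))
  have colS: "col S j = s j" if "j < n" for j
    using that s[OF that] by (simp add: S_def)
  have TS: "T * S = 1\<^sub>m n"
  proof (rule mat_col_eqI)
    fix j assume "j < dim_col (1\<^sub>m n)"
    then have j: "j < n" by simp
    show "col (T * S) j = col (1\<^sub>m n) j"
      using s[OF j] col_mult2[OF T S j] j by (simp add: colS)
  qed (use T S in auto)
  have ST: "S * T = 1\<^sub>m m"
  proof -
    have D: "S * T - 1\<^sub>m m \<in> carrier_mat m m" by (intro minus_carrier_mat) simp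
    have "S * T - 1\<^sub>m m = 0\<^sub>m m m"
    proof (rule mat_eq_zeroI[OF D])
      fix v :: "complex vec" assume v: "v \<in> carrier_vec m"
      have "T * (S * T - 1\<^sub>m m) = T * S * T - T"
        by (simp add: mult_minus_distrib_mat[OF T mult_carrier_mat[OF S T] one_carrier_mat]
            assoc_mult_mat[OF T S T] right_mult_one_mat[OF T])
      also have "\<dots> = 0\<^sub>m n m" using T by (simp add: TS)
      finally have "T *\<^sub>v ((S * T - 1\<^sub>m m) *\<^sub>v v) = 0\<^sub>v n"
        using assoc_mult_mat_vec[OF T D v] zero_mult_mat_vec[OF v, of n] by simp
      then have "(S * T - 1\<^sub>m m) *\<^sub>v v \<in> ker" using D v by (simp add: ker_def)
      then show "(S * T - 1\<^sub>m m) *\<^sub>v v = 0\<^sub>v m" using inj by simp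
    qed
    then have "(S * T - 1\<^sub>m m) + 1\<^sub>m m = 1\<^sub>m m" by simp
    then show ?thesis using S T 
      by (intro eq_matI) (auto simp: mat_eq_iff)
  qed
  show thesis using that S TS ST by blast
qed

text \<open>Subtracting an eigenvalue \<open>c\<close> of \<open>T\<close> leaves an intertwiner with nontrivial kernel, which
  must vanish.\<close>

theorem schur_scalar:
  assumes irr: "irreducible_rep G n \<rho>" and T: "T \<in> carrier_mat n n"
    and comm: "\<And>g. g \<in> carrier G \<Longrightarrow> \<rho> g * T = T * \<rho> g"
  obtains c where "T = c \<cdot>\<^sub>m 1\<^sub>m n"
proof -
  note \<rho> = complex_rep_carrier[OF irreducible_repD(1)[OF irr]]
  from spectrum_non_empty[OF T] irreducible_repD(2)[OF irr]
  obtain c v where v: "v \<in> carrier_vec n" "v \<noteq> 0\<^sub>v n" and ev: "T *\<^sub>v v = c \<cdot>\<^sub>v v"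
    using T by (auto simp: spectrum_def eigenvalue_def eigenvector_def)
  define D where "D = T - c \<cdot>\<^sub>m 1\<^sub>m n"
  have D: "D \<in> carrier_mat n n" unfolding D_def by (intro minus_carrier_mat) simp
  have Dv: "D *\<^sub>v v = 0\<^sub>v n"
    using T v ev by (auto simp: D_def minus_mult_distrib_mat_vec)
  have "\<rho> g * D = D * \<rho> g" if "g \<in> carrier G" for g
    using \<rho>[OF that] T comm[OF that]
    by (simp add: D_def mult_minus_distrib_mat[of _ n n] minus_mult_distrib_mat[of _ n n]
        mult_smult_distrib[OF \<rho>[OF that] one_carrier_mat]
        mult_smult_assoc_mat[OF one_carrier_mat \<rho>[OF that]])
  then have "D = 0\<^sub>m n n"
  proof (rule_tac ccontr)
    assume "D \<noteq> 0\<^sub>m n n"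
    with schur_zero_or_invertible[OF irr irr D] \<open>\<And>g. g \<in> carrier G \<Longrightarrow> \<rho> g * D = D * \<rho> g\<close>
    obtain S where S: "S \<in> carrier_mat n n" "S * D = 1\<^sub>m n" by blast
    have "v = S *\<^sub>v (D *\<^sub>v v)" using v assoc_mult_mat_vec[OF S(1) D v(1)] S(2) by simp
    then show False using v mult_mat_vec_zero[OF S(1)] by (simp add: Dv)
  qed
  then have "T = c \<cdot>\<^sub>m 1\<^sub>m n"
    using T by (auto simp: D_def mat_eq_iff)
  then show thesis by (rule that)
qed

section \<open>Characters at inverse elements\<close>

lemma mat_adjoint_carrier: "(A :: complex mat) \<in> carrier_mat n m \<Longrightarrow> mat_adjoint A \<in> carrier_mat m n"
  by (auto simp: mat_adjoint_def)

lemma mat_adjoint_index: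
  "A \<in> carrier_mat n m \<Longrightarrow> i < m \<Longrightarrow> j < n \<Longrightarrow> mat_adjoint A $$ (i, j) = cnj (A $$ (j, i))"
  by (simp add: mat_adjoint_def mat_of_rows_index conjugate_complex_def)

lemma mat_adjoint_mult:
  assumes A: "(A :: complex mat) \<in> carrier_mat n m" and B: "B \<in> carrier_mat m l"
  shows "mat_adjoint (A * B) = mat_adjoint B * mat_adjoint A"
proof (rule eq_matI)
  fix i j assume "i < dim_row (mat_adjoint B * mat_adjoint A)" "j < dim_col (mat_adjoint B * mat_adjoint A)"
  then have ij: "i < l" "j < n" using A B by (simp_all add: mat_adjoint_def)
  show "mat_adjoint (A * B) $$ (i, j) = (mat_adjoint B * mat_adjoint A) $$ (i, j)"
    using ij A B
    by (simp add: mult_mat_index[OF mat_adjoint_carrier[OF B] mat_adjoint_carrier[OF A]]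
        mat_adjoint_index[OF mult_carrier_mat[OF A B]] mat_adjoint_index[OF A] mat_adjoint_index[OF B]
        mult_mat_index[OF A B] mult.commute del: index_mult_mat)
qed (use A B in \<open>auto simp: mat_adjoint_def\<close>)

lemma mat_trace_mat_adjoint: "A \<in> carrier_mat n n \<Longrightarrow> mat_trace (mat_adjoint A) = cnj (mat_trace A)"
  using mat_adjoint_carrier[of A n n] by (simp add: mat_trace_def mat_adjoint_index)

text \<open>The Hermitian form of \<open>A\<^sup>* A\<close> at \<open>v\<close> is the squared length of \<open>A v\<close>; this is what makes the
  Hermitian form averaged over a group positive definite.\<close>

lemma mat_adjoint_mult_self_form:
  assumes A: "A \<in> carrier_mat n m" and v: "v \<in> carrier_vec m"
  shows "(\<Sum>i<m. ((mat_adjoint A * A) *\<^sub>v v) $ i * cnj (v $ i))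
      = of_real (\<Sum>k<n. (cmod ((A *\<^sub>v v) $ k))\<^sup>2)"
proof -
  define w where "w = A *\<^sub>v v"
  have w: "w \<in> carrier_vec n" using A v by (simp add: w_def)
  have "(\<Sum>i<m. ((mat_adjoint A * A) *\<^sub>v v) $ i * cnj (v $ i))
      = (\<Sum>i<m. \<Sum>k<n. cnj (A $$ (k, i)) * w $ k * cnj (v $ i))"
    using mult_mat_vec_index[OF mat_adjoint_carrier[OF A] w]
    by (simp add: assoc_mult_mat_vec[OF mat_adjoint_carrier[OF A] A v] mat_adjoint_index[OF A]
        sum_distrib_right flip: w_def)
  also have "\<dots> = (\<Sum>k<n. w $ k * cnj (\<Sum>i<m. A $$ (k, i) * v $ i))"
    by (subst sum.swap) (simp add: sum_distrib_left mult_ac)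
  also have "\<dots> = (\<Sum>k<n. w $ k * cnj (w $ k))"
    by (intro sum.cong refl) (simp add: mult_mat_vec_index[OF A v] w_def)
  finally show ?thesis
    unfolding w_def of_real_sum complex_norm_square .
qed

lemma mat_sum_mult_vec_index:
  assumes f: "\<And>x. x \<in> I \<Longrightarrow> f x \<in> carrier_mat n m" and v: "v \<in> carrier_vec m" and i: "i < n"
  shows "(mat_sum n m f I *\<^sub>v v) $ i = (\<Sum>x\<in>I. (f x *\<^sub>v v) $ i)"
proof -
  have "(mat_sum n m f I *\<^sub>v v) $ i = (\<Sum>j<m. \<Sum>x\<in>I. f x $$ (i, j) * v $ j)"
    using i by (simp add: mult_mat_vec_index[OF mat_sum_carrier v i] sum_distrib_right)
  also have "\<dots> = (\<Sum>x\<in>I. (f x *\<^sub>v v) $ i)"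
    by (subst sum.swap) (simp add: mult_mat_vec_index[OF f v i])
  finally show ?thesis .
qed

text \<open>Averaging the standard Hermitian form over the group gives a positive definite form
  \<open>H = (\<Sum>x\<in>G. \<rho> x\<^sup>* \<rho> x)\<close> that \<open>\<rho>\<close> preserves. Hence \<open>H\<close> intertwines \<open>\<rho> (inv g)\<close> with the
  adjoint of \<open>\<rho> g\<close>, and the two have the same trace.\<close>

theorem (in group) mat_trace_inv:
  assumes fin: "finite (carrier G)" and rep: "complex_rep G n \<rho>" and g: "g \<in> carrier G"
  shows "mat_trace (\<rho> (inv g)) = cnj (mat_trace (\<rho> g))"
proof -
  note \<rho> = complex_rep_carrier[OF rep]
  note \<rho>' = mat_adjoint_carrier[OF \<rho>]
  define f where "f x = mat_adjoint (\<rho> x) * \<rho> x" for x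
  define H where "H = mat_sum n n f (carrier G)"
  have f: "f x \<in> carrier_mat n n" if "x \<in> carrier G" for x
    using \<rho>[OF that] \<rho>'[OF that] by (simp add: f_def)
  have H: "H \<in> carrier_mat n n" by (simp add: H_def)
  have gi: "inv g \<in> carrier G" using g by simp
  have "mat_adjoint (\<rho> g) * H = mat_sum n n (\<lambda>x. mat_adjoint (\<rho> g) * f x) (carrier G)"
    unfolding H_def using f by (intro mult_mat_sum \<rho>'[OF g])
  also have "\<dots> = mat_sum n n (\<lambda>x. f x * \<rho> (inv g)) (carrier G)"
  proof (rule mat_sum_reindex)
    show "bij_betw (\<lambda>x. x \<otimes> g) (carrier G) (carrier G)"
      by (rule bij_betw_byWitness[where f' = "\<lambda>x. x \<otimes> inv g"]) (use g in \<open>auto simp: m_assoc\<close>)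
  next
    fix x assume x: "x \<in> carrier G"
    have xg: "x \<otimes> g \<in> carrier G" using x g by simp
    have "mat_adjoint (\<rho> g) * f x = mat_adjoint (\<rho> g) * mat_adjoint (\<rho> x) * \<rho> x"
      unfolding f_def by (rule assoc_mult_mat[OF \<rho>'[OF g] \<rho>'[OF x] \<rho>[OF x], symmetric])
    also have "mat_adjoint (\<rho> g) * mat_adjoint (\<rho> x) = mat_adjoint (\<rho> (x \<otimes> g))"
      by (simp add: complex_rep_mult[OF rep x g] mat_adjoint_mult[OF \<rho>[OF x] \<rho>[OF g]])
    also have "\<rho> x = \<rho> (x \<otimes> g) * \<rho> (inv g)"
      using complex_rep_mult[OF rep xg gi] x g by (simp add: m_assoc)
    also have "mat_adjoint (\<rho> (x \<otimes> g)) * (\<rho> (x \<otimes> g) * \<rho> (inv g)) = f (x \<otimes> g) * \<rho> (inv g)"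
      unfolding f_def by (rule assoc_mult_mat[OF \<rho>'[OF xg] \<rho>[OF xg] \<rho>[OF gi], symmetric])
    finally show "mat_adjoint (\<rho> g) * f x = f (x \<otimes> g) * \<rho> (inv g)" .
  qed
  also have "\<dots> = H * \<rho> (inv g)"
    unfolding H_def using f by (intro mat_sum_mult[symmetric] \<rho>[OF gi])
  finally have comm: "mat_adjoint (\<rho> g) * H = H * \<rho> (inv g)" .
  \<comment> \<open>A kernel vector \<open>v\<close> of \<open>H\<close> satisfies \<open>\<rho> x v = 0\<close> for every \<open>x\<close>, in particular for \<open>x = \<one>\<close>.\<close>
  have "det H \<noteq> 0"
  proof
    assume "det H = 0"
    then obtain v where v: "v \<in> carrier_vec n" "v \<noteq> 0\<^sub>v n" "H *\<^sub>v v = 0\<^sub>v n"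
      using det_0_iff_vec_prod_zero_field[OF H] by auto
    have "0 = (\<Sum>i<n. (H *\<^sub>v v) $ i * cnj (v $ i))" using v by simp
    also have "\<dots> = (\<Sum>i<n. \<Sum>x\<in>carrier G. (f x *\<^sub>v v) $ i * cnj (v $ i))"
      unfolding H_def using f v(1)
      by (intro sum.cong refl)
         (simp add: mat_sum_mult_vec_index sum_distrib_right del: index_mult_mat_vec)
    also have "\<dots> = (\<Sum>x\<in>carrier G. of_real (\<Sum>k<n. (cmod ((\<rho> x *\<^sub>v v) $ k))\<^sup>2))"
      by (subst sum.swap) (simp add: f_def mat_adjoint_mult_self_form[OF \<rho> v(1)] del: of_real_sum)
    finally have "complex_of_real (\<Sum>x\<in>carrier G. \<Sum>k<n. (cmod ((\<rho> x *\<^sub>v v) $ k))\<^sup>2) = 0"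
      unfolding of_real_sum[of _ "carrier G"] by (rule sym)
    then have "(\<Sum>x\<in>carrier G. \<Sum>k<n. (cmod ((\<rho> x *\<^sub>v v) $ k))\<^sup>2) = 0"
      unfolding of_real_eq_0_iff .
    then have "(\<Sum>k<n. (cmod ((\<rho> \<one> *\<^sub>v v) $ k))\<^sup>2) = 0"
      using fin by (subst (asm) sum_nonneg_eq_0_iff) (auto intro: sum_nonneg)
    then have "\<forall>k<n. v $ k = 0"
      using v(1) by (simp add: complex_rep_one[OF rep] sum_nonneg_eq_0_iff)
    then show False using v by auto
  qed
  then obtain S where S: "S \<in> carrier_mat n n" "H * S = 1\<^sub>m n" "S * H = 1\<^sub>m n"
    using det_non_zero_imp_unit[OF H, of "()"] by (auto simp: Units_def ring_mat_simps)
  show ?thesis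
    using mat_trace_eq_of_intertwining_invertible[OF \<rho>'[OF g] \<rho>[OF gi] H S comm]
    by (simp add: mat_trace_mat_adjoint[OF \<rho>[OF g]])
qed

section \<open>Orthogonality of irreducible characters\<close>

definition mat_unit :: "nat \<Rightarrow> nat \<Rightarrow> nat \<Rightarrow> nat \<Rightarrow> complex mat" where
  "mat_unit n m p q = mat n m (\<lambda>ij. if ij = (p, q) then 1 else 0)"

lemma mat_unit_carrier: "mat_unit n m p q \<in> carrier_mat n m"
  by (simp add: mat_unit_def)

lemma mult_mat_unit_mult_index:
  assumes A: "A \<in> carrier_mat n n" and B: "B \<in> carrier_mat m m"
    and "p < n" "q < m" "i < n" "j < m"
  shows "(A * mat_unit n m p q * B) $$ (i, j) = A $$ (i, p) * B $$ (q, j)"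
proof -
  have E: "A * mat_unit n m p q \<in> carrier_mat n m"
    using A by (auto simp: mat_unit_def)
  have "(A * mat_unit n m p q) $$ (i, r) = (if r = q then A $$ (i, p) else 0)" if "r < m" for r
  proof -
    have "(A * mat_unit n m p q) $$ (i, r) = (\<Sum>s<n. A $$ (i, s) * (if s = p \<and> r = q then 1 else 0))"
      using that assms
      by (simp add: mult_mat_index[OF A mat_unit_carrier] del: index_mult_mat) (simp add: mat_unit_def)
    also have "\<dots> = (\<Sum>s<n. if s = p then (if r = q then A $$ (i, p) else 0) else 0)"
      by (intro sum.cong) auto
    finally show ?thesis using assms by simp
  qed
  then have "(A * mat_unit n m p q * B) $$ (i, j) = (\<Sum>r<m. if r = q then A $$ (i, p) * B $$ (q, j) else 0)"
    unfolding mult_mat_index[OF E B \<open>i < n\<close> \<open>j < m\<close>] by (intro sum.cong) auto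
  then show ?thesis using assms by simp
qed

lemma mat_trace_mat_unit: "p < n \<Longrightarrow> q < n \<Longrightarrow> mat_trace (mat_unit n n p q) = (if p = q then 1 else 0)"
proof -
  assume pq: "p < n" "q < n"
  have "mat_trace (mat_unit n n p q) = (\<Sum>i<n. if i = p then (if p = q then 1 else 0) else 0)"
    unfolding mat_trace_def mat_unit_def by (intro sum.cong) auto
  then show ?thesis using pq by simp
qed

text \<open>This is the sum and not the mean over the group, matching the orthogonality relations below,
  which are stated for sums.\<close>

definition group_average ::
  "('g, 'b) monoid_scheme \<Rightarrow> nat \<Rightarrow> nat \<Rightarrow> ('g \<Rightarrow> complex mat) \<Rightarrow> ('g \<Rightarrow> complex mat) \<Rightarrow>
    complex mat \<Rightarrow> complex mat" where
  "group_average G n m \<rho> \<sigma> B = mat_sum n m (\<lambda>x. \<rho> x * B * \<sigma> (inv\<^bsub>G\<^esub> x)) (carrier G)"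

text \<open>Conjugating by \<open>g\<close> only permutes the summands, by \<open>x \<mapsto> g x\<close>.\<close>

lemma (in group) group_average_intertwines:
  assumes rep\<rho>: "complex_rep G n \<rho>" and rep\<sigma>: "complex_rep G m \<sigma>"
    and B: "B \<in> carrier_mat n m" and g: "g \<in> carrier G"
  shows "\<rho> g * group_average G n m \<rho> \<sigma> B = group_average G n m \<rho> \<sigma> B * \<sigma> g"
proof -
  note \<rho> = complex_rep_carrier[OF rep\<rho>]
  note \<sigma> = complex_rep_carrier[OF rep\<sigma>]
  define f where "f x = \<rho> x * B * \<sigma> (inv x)" for x
  have f: "f x \<in> carrier_mat n m" if "x \<in> carrier G" for x
    using \<rho>[OF that] \<sigma>[of "inv x"] that B by (simp add: f_def)
  have "\<rho> g * mat_sum n m f (carrier G) = mat_sum n m (\<lambda>x. \<rho> g * f x) (carrier G)"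
    using f by (intro mult_mat_sum \<rho>[OF g])
  also have "\<dots> = mat_sum n m (\<lambda>x. f x * \<sigma> g) (carrier G)"
  proof (rule mat_sum_reindex)
    show "bij_betw (\<lambda>x. g \<otimes> x) (carrier G) (carrier G)"
      by (rule bij_betw_byWitness[where f' = "\<lambda>x. inv g \<otimes> x"]) (use g in \<open>auto simp flip: m_assoc\<close>)
  next
    fix x assume x: "x \<in> carrier G"
    have gx: "g \<otimes> x \<in> carrier G" and xi: "inv x \<in> carrier G" and gxi: "inv (g \<otimes> x) \<in> carrier G"
      using x g by simp_all
    have "\<sigma> (inv x) = \<sigma> (inv (g \<otimes> x)) * \<sigma> g"
      using x g complex_rep_mult[OF rep\<sigma> gxi g] by (simp add: inv_mult_group m_assoc)
    then have "\<rho> g * f x = \<rho> g * (\<rho> x * B * (\<sigma> (inv (g \<otimes> x)) * \<sigma> g))"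
      by (simp add: f_def)
    also have "\<dots> = \<rho> g * \<rho> x * B * \<sigma> (inv (g \<otimes> x)) * \<sigma> g"
      using \<rho>[OF g] \<rho>[OF x] \<sigma>[OF g] \<sigma>[OF gxi] B
      by (simp add: assoc_mult_mat[of _ n n _ n _ m] assoc_mult_mat[of _ n n _ m _ m]
          assoc_mult_mat[of _ n m _ m _ m])
    also have "\<rho> g * \<rho> x = \<rho> (g \<otimes> x)" by (rule complex_rep_mult[OF rep\<rho> g x, symmetric])
    finally show "\<rho> g * f x = f (g \<otimes> x) * \<sigma> g" by (simp add: f_def)
  qed
  also have "\<dots> = mat_sum n m f (carrier G) * \<sigma> g"
    using f by (intro mat_sum_mult[symmetric] \<sigma>[OF g])
  finally show ?thesis by (simp add: group_average_def f_def[abs_def])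
qed

text \<open>The \<open>(p, q)\<close> entry of the average of the matrix unit at \<open>(p, q)\<close> is the sum of
  \<open>\<rho> g $$ (p, p) * \<sigma> (inv g) $$ (q, q)\<close>, so summing over \<open>p\<close> and \<open>q\<close> produces the two traces. This
  reduces the inner product of two characters to intertwiners, to which Schur's lemma applies.\<close>

lemma (in group) sum_mat_trace_mult:
  assumes rep\<rho>: "complex_rep G n \<rho>" and rep\<sigma>: "complex_rep G m \<sigma>"
  shows "(\<Sum>g\<in>carrier G. mat_trace (\<rho> g) * mat_trace (\<sigma> (inv g)))
      = (\<Sum>p<n. \<Sum>q<m. group_average G n m \<rho> \<sigma> (mat_unit n m p q) $$ (p, q))"
proof -
  note \<rho> = complex_rep_carrier[OF rep\<rho>]
  note \<sigma> = complex_rep_carrier[OF rep\<sigma>]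
  have "(\<Sum>p<n. \<Sum>q<m. group_average G n m \<rho> \<sigma> (mat_unit n m p q) $$ (p, q))
      = (\<Sum>p<n. \<Sum>q<m. \<Sum>g\<in>carrier G. \<rho> g $$ (p, p) * \<sigma> (inv g) $$ (q, q))"
    unfolding group_average_def
    using \<rho> \<sigma> by (intro sum.cong refl) (simp add: mult_mat_unit_mult_index del: index_mult_mat)
  also have "\<dots> = (\<Sum>p<n. \<Sum>g\<in>carrier G. \<Sum>q<m. \<rho> g $$ (p, p) * \<sigma> (inv g) $$ (q, q))"
    by (intro sum.cong refl sum.swap)
  also have "\<dots> = (\<Sum>g\<in>carrier G. \<Sum>p<n. \<Sum>q<m. \<rho> g $$ (p, p) * \<sigma> (inv g) $$ (q, q))"
    by (rule sum.swap)
  also have "\<dots> = (\<Sum>g\<in>carrier G. mat_trace (\<rho> g) * mat_trace (\<sigma> (inv g)))"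
  proof (intro sum.cong refl)
    fix g assume "g \<in> carrier G"
    then have "dim_row (\<rho> g) = n" "dim_row (\<sigma> (inv g)) = m" using \<rho> \<sigma>[of "inv g"] by auto
    then show "(\<Sum>p<n. \<Sum>q<m. \<rho> g $$ (p, p) * \<sigma> (inv g) $$ (q, q))
        = mat_trace (\<rho> g) * mat_trace (\<sigma> (inv g))"
      by (simp add: mat_trace_def sum_product)
  qed
  finally show ?thesis by simp
qed

text \<open>A nonzero average would be an invertible intertwiner and would make the characters
  equal.\<close>

theorem (in group) character_inner_distinct:
  assumes fin: "finite (carrier G)"
    and irr\<rho>: "irreducible_rep G n \<rho>" and irr\<sigma>: "irreducible_rep G m \<sigma>"
    and ne: "rep_character G \<rho> \<noteq> rep_character G \<sigma>"
  shows "(\<Sum>g\<in>carrier G. rep_character G \<rho> g * cnj (rep_character G \<sigma> g)) = 0"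
proof -
  note rep\<rho> = irreducible_repD(1)[OF irr\<rho>] and rep\<sigma> = irreducible_repD(1)[OF irr\<sigma>]
  have zero: "group_average G n m \<rho> \<sigma> (mat_unit n m p q) = 0\<^sub>m n m" (is "?T = _") for p q
  proof (rule ccontr)
    have T: "?T \<in> carrier_mat n m" by (simp add: group_average_def)
    note comm = group_average_intertwines[OF rep\<rho> rep\<sigma> mat_unit_carrier]
    assume "?T \<noteq> 0\<^sub>m n m"
    with schur_zero_or_invertible[OF irr\<rho> irr\<sigma> T comm]
    obtain S where S: "S \<in> carrier_mat m n" "?T * S = 1\<^sub>m n" "S * ?T = 1\<^sub>m m" by blast
    have "rep_character G \<rho> = rep_character G \<sigma>"
      unfolding rep_character_def
      by (intro restrict_ext)
         (rule mat_trace_eq_of_intertwining_invertible[OF complex_rep_carrier[OF rep\<rho>]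
            complex_rep_carrier[OF rep\<sigma>] T S comm])
    with ne show False ..
  qed
  have "(\<Sum>g\<in>carrier G. rep_character G \<rho> g * cnj (rep_character G \<sigma> g))
      = (\<Sum>g\<in>carrier G. mat_trace (\<rho> g) * mat_trace (\<sigma> (inv g)))"
    by (intro sum.cong refl) (simp add: rep_character_def mat_trace_inv[OF fin rep\<sigma>])
  also have "\<dots> = 0" by (simp add: sum_mat_trace_mult[OF rep\<rho> rep\<sigma>] zero)
  finally show ?thesis .
qed

text \<open>Here every average is a scalar matrix, and the scalar is read off from its trace: averaging
  multiplies the trace of a matrix by the order of the group.\<close>

theorem (in group) character_inner_self:
  assumes fin: "finite (carrier G)" and irr: "irreducible_rep G n \<rho>"
  shows "(\<Sum>g\<in>carrier G. rep_character G \<rho> g * cnj (rep_character G \<rho> g)) = of_nat (card (carrier G))"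
proof -
  note rep = irreducible_repD(1)[OF irr]
  note \<rho> = complex_rep_carrier[OF rep]
  define N where "N = card (carrier G)"
  have diag: "group_average G n n \<rho> \<rho> (mat_unit n n p q) $$ (p, q) =
      (if p = q then of_nat N / of_nat n else 0)" (is "?T $$ _ = _") if pq: "p < n" "q < n" for p q
  proof -
    have T: "?T \<in> carrier_mat n n" by (simp add: group_average_def)
    obtain c where c: "?T = c \<cdot>\<^sub>m 1\<^sub>m n"
      using schur_scalar[OF irr T group_average_intertwines[OF rep rep mat_unit_carrier]] by blast
    have "of_nat n * c = mat_trace ?T" by (simp add: c mat_trace_def)
    also have "\<dots> = (\<Sum>g\<in>carrier G. mat_trace (\<rho> g * mat_unit n n p q * \<rho> (inv g)))"
      unfolding group_average_def
      by (rule mat_trace_mat_sum) (use \<rho> mat_unit_carrier in \<open>simp add: mult_carrier_mat[of _ n n]\<close>)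
    also have "\<dots> = (\<Sum>g\<in>carrier G. mat_trace (mat_unit n n p q))"
    proof (intro sum.cong refl)
      fix g assume g: "g \<in> carrier G"
      have gi: "inv g \<in> carrier G" using g by simp
      have "mat_trace (\<rho> g * mat_unit n n p q * \<rho> (inv g))
          = mat_trace (\<rho> (inv g) * (\<rho> g * mat_unit n n p q))"
        using \<rho>[OF g] \<rho>[OF gi] mat_unit_carrier by (intro mat_trace_mult_comm) auto
      also have "\<rho> (inv g) * (\<rho> g * mat_unit n n p q) = \<rho> (inv g \<otimes> g) * mat_unit n n p q"
        using \<rho>[OF g] \<rho>[OF gi]
        by (simp add: complex_rep_mult[OF rep gi g] assoc_mult_mat[OF _ _ mat_unit_carrier])
      finally show "mat_trace (\<rho> g * mat_unit n n p q * \<rho> (inv g)) = mat_trace (mat_unit n n p q)"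
        using g by (simp add: complex_rep_one[OF rep] left_mult_one_mat[OF mat_unit_carrier])
    qed
    finally have "of_nat n * c = of_nat N * (if p = q then 1 else 0)"
      using pq by (simp add: N_def mat_trace_mat_unit)
    then have "c = (if p = q then of_nat N / of_nat n else 0)"
      using irreducible_repD(2)[OF irr] by (auto simp: field_simps split: if_splits)
    then show ?thesis using pq by (simp add: c)
  qed
  have "(\<Sum>g\<in>carrier G. rep_character G \<rho> g * cnj (rep_character G \<rho> g))
      = (\<Sum>g\<in>carrier G. mat_trace (\<rho> g) * mat_trace (\<rho> (inv g)))"
    by (intro sum.cong refl) (simp add: rep_character_def mat_trace_inv[OF fin rep])
  also have "\<dots> = (\<Sum>p<n. \<Sum>q<n. if p = q then of_nat N / of_nat n else 0)"
    by (simp add: sum_mat_trace_mult[OF rep rep] diag)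
  also have "\<dots> = of_nat N"
    using irreducible_repD(2)[OF irr] by simp
  finally show ?thesis by (simp add: N_def)
qed

section \<open>Fourth moments and the values of the modulus\<close>

text \<open>Parseval's identity: injectivity makes the characters at different indices distinct, hence
  orthogonal, and each has squared norm \<open>\<bar>G\<bar>\<close> for the unnormalised inner product.\<close>

lemma (in group) sum_cmod_square_eq_sum_coeff_square:
  assumes fin: "finite (carrier G)" and I: "finite I"
    and inj: "inj_on X I" and irr: "X ` I \<subseteq> irreducible_characters G"
    and \<psi>: "\<And>g. g \<in> carrier G \<Longrightarrow> \<psi> g = (\<Sum>j\<in>I. of_real (c j) * X j g)"
  shows "(\<Sum>g\<in>carrier G. (cmod (\<psi> g))\<^sup>2) = real (card (carrier G)) * (\<Sum>j\<in>I. (c j)\<^sup>2)"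
proof -
  have orth: "(\<Sum>g\<in>carrier G. X i g * cnj (X j g)) = (if i = j then of_nat (card (carrier G)) else 0)"
    if ij: "i \<in> I" "j \<in> I" for i j
  proof -
    obtain n \<rho> where \<rho>: "irreducible_rep G n \<rho>" "X i = rep_character G \<rho>"
      using irr ij(1) by (auto simp: irreducible_characters_def)
    obtain m \<sigma> where \<sigma>: "irreducible_rep G m \<sigma>" "X j = rep_character G \<sigma>"
      using irr ij(2) by (auto simp: irreducible_characters_def)
    show ?thesis
    proof (cases "i = j")
      case True
      then show ?thesis using character_inner_self[OF fin \<rho>(1)] \<rho>(2) by simp
    next
      case False
      then have "X i \<noteq> X j" using inj ij by (auto dest: inj_onD)
      then show ?thesis
        using character_inner_distinct[OF fin \<rho>(1) \<sigma>(1)] False by (simp add: \<rho>(2) \<sigma>(2))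
    qed
  qed
  have "complex_of_real (\<Sum>g\<in>carrier G. (cmod (\<psi> g))\<^sup>2)
      = (\<Sum>g\<in>carrier G. (\<Sum>i\<in>I. of_real (c i) * X i g) * cnj (\<Sum>j\<in>I. of_real (c j) * X j g))"
    unfolding of_real_sum complex_norm_square by (intro sum.cong refl) (simp only: \<psi>)
  also have "\<dots> = (\<Sum>g\<in>carrier G. \<Sum>i\<in>I. \<Sum>j\<in>I. of_real (c i * c j) * (X i g * cnj (X j g)))"
    by (simp add: sum_product mult_ac)
  also have "\<dots> = (\<Sum>i\<in>I. \<Sum>g\<in>carrier G. \<Sum>j\<in>I. of_real (c i * c j) * (X i g * cnj (X j g)))"
    by (rule sum.swap)
  also have "\<dots> = (\<Sum>i\<in>I. \<Sum>j\<in>I. \<Sum>g\<in>carrier G. of_real (c i * c j) * (X i g * cnj (X j g)))"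
    by (intro sum.cong refl sum.swap)
  also have "\<dots> = (\<Sum>i\<in>I. \<Sum>j\<in>I. if i = j then of_real (c i * c j) * of_nat (card (carrier G)) else 0)"
    by (intro sum.cong refl) (simp add: orth flip: sum_distrib_left)
  also have "\<dots> = complex_of_real (real (card (carrier G)) * (\<Sum>j\<in>I. (c j)\<^sup>2))"
    using I by (simp add: sum_distrib_left power2_eq_square mult_ac)
  finally show ?thesis unfolding of_real_eq_iff .
qed

lemma modulus_values_facts:
  assumes "finite (carrier G)"
  shows set_modulus_values:
      "set (modulus_values G \<chi> n) = (\<lambda>g. cmod (\<chi> g)) ` carrier G - {real n}"
    and distinct_modulus_values: "distinct (modulus_values G \<chi> n)"
    and modulus_values_antimono:
      "i \<le> j \<Longrightarrow> j < length (modulus_values G \<chi> n) \<Longrightarrow>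
        modulus_values G \<chi> n ! j \<le> modulus_values G \<chi> n ! i"
  using assms by (auto simp: modulus_values_def rev_nth intro!: sorted_nth_mono)

lemma le_root_4I: "0 \<le> x \<Longrightarrow> x ^ 4 \<le> y \<Longrightarrow> x \<le> root 4 y"
  using real_root_le_mono[of 4 "x ^ 4" y] by (simp add: real_root_power_cancel)

lemma root_4_leI: "0 \<le> y \<Longrightarrow> x \<le> y ^ 4 \<Longrightarrow> root 4 x \<le> y"
  using real_root_le_mono[of 4 x "y ^ 4"] by (simp add: real_root_power_cancel)

theorem corollary1p3:
  fixes G :: "('g, 'b) monoid_scheme"
    and n k l :: nat
    and \<rho> :: "'g \<Rightarrow> complex mat"
    and \<chi> :: "'g \<Rightarrow> complex"
    and K G0 :: "'g set"
    and C :: "nat \<Rightarrow> 'g set"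
    and \<gamma> :: "nat \<Rightarrow> real"
    and X :: "nat \<Rightarrow> 'g \<Rightarrow> complex"
    and a :: "nat \<Rightarrow> nat"
  assumes "group G" and "finite (carrier G)" and "\<not> comm_group G"
    and "irreducible_rep G n \<rho>" and "n > 1"
    and "\<chi> = rep_character G \<rho>"
    and "K = modulus_level_set G \<chi> (real n)"
    and "G0 = modulus_level_set G \<chi> 0"
    and "\<gamma> = (\<lambda>q. modulus_values G \<chi> n ! q)"
    and "l = length (modulus_values G \<chi> n) - 1"
    and "C = (\<lambda>q. modulus_level_set G \<chi> (\<gamma> q))"
    and "\<gamma> 0 > 0"
    and "bij_betw X {1..k} (irreducible_characters_trivial_on G K)"
    and "X 1 = (\<lambda>g \<in> carrier G. 1)"
    and "\<forall>g \<in> carrier G. \<chi> g * cnj (\<chi> g) = (\<Sum>j = 1..k. of_nat (a j) * X j g)"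
  shows "(\<forall>i \<in> {1..l}. \<gamma> i \<le>
            root 4 (((\<Sum>j = 1..k. real (a j) ^ 2) - real n ^ 4 * real (card K) / real (card (carrier G)))
                    / ((\<Sum>q = 0..i. real (card (C q))) / real (card (carrier G)))))
       \<and> root 4 ((real (card (carrier G)) * (\<Sum>j = 1..k. real (a j) ^ 2) - real (card K) * real n ^ 4)
                 / (real (card (carrier G)) - real (card G0) - real (card K)))
           \<le> \<gamma> 0
       \<and> \<gamma> 0 \<le>
         root 4 ((real (card (carrier G)) * (\<Sum>j = 1..k. real (a j) ^ 2) - real (card K) * real n ^ 4)
                 / real (card (C 0)))"
proof -
  interpret group G by fact
  let ?G = "carrier G" and ?L = "modulus_values G \<chi> n"
  note fin [simp] = \<open>finite (carrier G)\<close>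
  note level = modulus_level_set_def
  define m where "m = real (card ?G)"
  have m: "m > 0"
    using fin one_closed by (auto simp: m_def card_gt_0_iff)
  define R where "R = (\<Sum>g\<in>?G - K. cmod (\<chi> g) ^ 4)"
  have K: "K \<subseteq> ?G" "g \<in> K \<Longrightarrow> cmod (\<chi> g) = n" for g
    by (auto simp: assms level)
  have R: "R = m * (\<Sum>j = 1..k. real (a j) ^ 2) - real (card K) * real n ^ 4"
  proof -
    \<comment> \<open>Parseval is applied to the real-valued class function \<open>\<bar>\<chi>\<bar>\<^sup>2\<close>, whose coefficients are the \<open>a j\<close>.\<close>
    have "(\<Sum>g\<in>?G. cmod (\<chi> g) ^ 4) = (\<Sum>g\<in>?G. (cmod (of_real ((cmod (\<chi> g))\<^sup>2)))\<^sup>2)"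
      by (simp add: norm_power flip: power_mult)
    also have "\<dots> = m * (\<Sum>j\<in>{1..k}. (real (a j))\<^sup>2)"
      unfolding m_def
    proof (rule sum_cmod_square_eq_sum_coeff_square[where X = X])
      show "inj_on X {1..k}" "X ` {1..k} \<subseteq> irreducible_characters G"
        using \<open>bij_betw X _ _\<close> by (auto simp: bij_betw_def irreducible_characters_trivial_on_def)
    next
      fix g assume "g \<in> ?G"
      then show "complex_of_real ((cmod (\<chi> g))\<^sup>2) = (\<Sum>j\<in>{1..k}. of_real (real (a j)) * X j g)"
        using assms(15) by (simp only: complex_norm_square) simp
    qed simp_all
    finally have "m * (\<Sum>j = 1..k. real (a j) ^ 2) = R + (\<Sum>g\<in>K. cmod (\<chi> g) ^ 4)"
      using sum.subset_diff[OF K(1) fin, of "\<lambda>g. cmod (\<chi> g) ^ 4"] by (simp add: R_def)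
    then show ?thesis using K(2) by simp
  qed
  have L_set: "set ?L = (\<lambda>g. cmod (\<chi> g)) ` ?G - {real n}"
    by (rule set_modulus_values[OF fin])
  \<comment> \<open>Otherwise \<open>\<bar>\<chi>\<bar> = n\<close> everywhere, and \<open>(\<chi>, \<chi>) = 1\<close> would give \<open>n = 1\<close>.\<close>
  have L_nonempty: "?L \<noteq> []"
  proof
    assume "?L = []"
    then have const: "cmod (\<chi> g) = n" if "g \<in> ?G" for g
      using L_set that by auto
    have "complex_of_real m = complex_of_real (\<Sum>g\<in>?G. (cmod (\<chi> g))\<^sup>2)"
      using character_inner_self[OF fin \<open>irreducible_rep G n \<rho>\<close>]
      unfolding of_real_sum complex_norm_square assms(6) m_def by simp
    then have "m = m * (real n)\<^sup>2"
      unfolding of_real_eq_iff by (simp add: const m_def)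
    then have "(real n)\<^sup>2 = 1" using m by simp
    then show False using \<open>n > 1\<close> by (simp add: power2_eq_1_iff)
  qed
  have \<gamma>_in: "\<gamma> i \<in> set ?L" if "i < length ?L" for i
    using that by (simp add: assms(9))
  have \<gamma>_nonneg: "\<gamma> i \<ge> 0" and \<gamma>_ne: "\<gamma> i \<noteq> n" if "i < length ?L" for i
    using \<gamma>_in[OF that] L_set by auto
  have C_nonempty: "card (C i) > 0" if "i < length ?L" for i
    using \<gamma>_in[OF that] L_set by (auto simp: card_gt_0_iff assms(11) level)
  have level_bound: "\<gamma> i ^ 4 * (\<Sum>q = 0..i. real (card (C q))) \<le> R" if i: "i < length ?L" for i
  proof -
    have "\<gamma> i ^ 4 * (\<Sum>q = 0..i. real (card (C q))) = (\<Sum>q = 0..i. \<Sum>g\<in>C q. \<gamma> i ^ 4)"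
      by (simp add: sum_distrib_left mult.commute)
    also have "\<dots> \<le> (\<Sum>q = 0..i. \<Sum>g\<in>C q. cmod (\<chi> g) ^ 4)"
    proof (intro sum_mono power_mono \<gamma>_nonneg[OF i])
      fix q g assume "q \<in> {0..i}" "g \<in> C q"
      then show "\<gamma> i \<le> cmod (\<chi> g)"
        using modulus_values_antimono[OF fin, of q i \<chi> n] i by (simp add: assms(9,11) level)
    qed
    also have "\<dots> = (\<Sum>g\<in>(\<Union>q\<in>{0..i}. C q). cmod (\<chi> g) ^ 4)"
    proof (rule sum.UNION_disjoint[symmetric])
      show "\<forall>q\<in>{0..i}. \<forall>r\<in>{0..i}. q \<noteq> r \<longrightarrow> C q \<inter> C r = {}"
        using distinct_modulus_values[OF fin, of \<chi> n] i
        by (auto simp: assms(9,11) level nth_eq_iff_index_eq)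
    qed (auto simp: assms(11) level)
    also have "\<dots> \<le> R"
      unfolding R_def
    proof (rule sum_mono2)
      have "\<gamma> q \<noteq> n" if "q \<le> i" for q
        using \<gamma>_ne[OF le_less_trans[OF that i]] .
      then show "(\<Union>q\<in>{0..i}. C q) \<subseteq> ?G - K"
        unfolding assms(7,11) level by fastforce
    qed auto
    finally show ?thesis .
  qed
  have "\<gamma> i \<le> root 4 (((\<Sum>j = 1..k. real (a j) ^ 2) - real n ^ 4 * real (card K) / m)
                    / ((\<Sum>q = 0..i. real (card (C q))) / m))" if i: "i < length ?L" for i
  proof -
    have c: "(\<Sum>q = 0..i. real (card (C q))) > 0"
      using C_nonempty[OF i] by (intro sum_pos2[of _ i]) auto
    have "((\<Sum>j = 1..k. real (a j) ^ 2) - real n ^ 4 * real (card K) / m)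
        / ((\<Sum>q = 0..i. real (card (C q))) / m) = R / (\<Sum>q = 0..i. real (card (C q)))"
      using m c by (simp add: R field_simps)
    then show ?thesis
      using level_bound[OF i] c by (auto intro!: le_root_4I \<gamma>_nonneg[OF i] simp: pos_le_divide_eq)
  qed
  moreover have "i < length ?L" if "i \<in> {1..l}" for i
    using that by (auto simp: assms(10))
  moreover have L0: "0 < length ?L" using L_nonempty by simp
  have "\<gamma> 0 \<le> root 4 (R / real (card (C 0)))"
    using level_bound[OF L0] C_nonempty[OF L0]
    by (auto intro!: le_root_4I \<gamma>_nonneg[OF L0] simp: pos_le_divide_eq)
  moreover have "root 4 (R / (m - real (card G0) - real (card K))) \<le> \<gamma> 0"
  proof (rule root_4_leI[OF \<gamma>_nonneg[OF L0]])
    let ?D = "?G - K - G0"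
    have sub: "G0 \<subseteq> ?G - K" using \<open>n > 1\<close> by (auto simp: assms(7,8) level)
    have card: "real (card ?D) = m - real (card G0) - real (card K)"
      using sub K(1) card_mono[OF _ sub] card_mono[OF fin K(1)]
      by (simp add: card_Diff_subset finite_subset[OF _ fin] finite_subset[OF sub] m_def of_nat_diff)
    have "C 0 \<subseteq> ?D"
      using \<gamma>_ne[OF L0] \<open>\<gamma> 0 > 0\<close> by (auto simp: assms(7,8,11) level)
    then have pos: "real (card ?D) > 0"
      using C_nonempty[OF L0] card_mono[of ?D "C 0"] by simp
    have "R = (\<Sum>g\<in>?D. cmod (\<chi> g) ^ 4)"
      unfolding R_def by (rule sum.mono_neutral_right) (use sub in \<open>auto simp: assms(8) level\<close>)
    also have "\<dots> \<le> (\<Sum>g\<in>?D. \<gamma> 0 ^ 4)"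
    proof (intro sum_mono power_mono)
      fix g assume "g \<in> ?D"
      then have "cmod (\<chi> g) \<in> set ?L" by (auto simp: L_set assms(7) level)
      then obtain i where "i < length ?L" "cmod (\<chi> g) = \<gamma> i"
        by (auto simp: in_set_conv_nth assms(9))
      then show "cmod (\<chi> g) \<le> \<gamma> 0"
        using modulus_values_antimono[OF fin, of 0 i \<chi> n] by (simp add: assms(9))
    qed simp
    finally show "R / (m - real (card G0) - real (card K)) \<le> \<gamma> 0 ^ 4"
      using pos by (simp add: pos_divide_le_eq mult.commute flip: card)
  qed
  ultimately show ?thesis unfolding R m_def by blast
qed

end
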